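(* For every integer $n\ge 1$ the generating function $$f_{2n}(t)=\sum_{m=0}^\infty Z(P_m\times C_{2n})\,t^m$$ is a rational function such that all zeroes of its denominator are complex roots of unity; that is, there are polynomials $p,q$ with $q\neq 0$ such that $f_{2n}(t)=p(t)/q(t)$ and every complex zero of $q$ is a root of unity.
   Context: $P_m$ is the path with $m$ vertices ($P_0$ is the empty graph), $C_n$ is the cycle with $n$ vertices, with the convention $C_2=P_2$ (a single edge). $G\times H$ denotes the Cartesian (grid) product of graphs: $(u,v)$ and $(u',v')$ are adjacent iff ($u=u'$ and $v,v'$ are adjacent in $H$) or ($v=v'$ and $u,u'$ are adjacent in $G$). For a finite graph $G$, $\mathrm{Ind}(G)$ is the independence complex, the simplicial complex whose simplices are the independent sets of $G$. For a finite simplicial complex $X$ put $Z(X)=1-\chi(X)$, where $\chi$ is the unreduced Euler characteristic, and put $Z(G)=Z(\mathrm{Ind}(G))$; equivalently $Z(G)=\sum_{\sigma}(-1)^{|\sigma|}$ over all independent sets $\sigma$ of $G$, including the empty one. In particular $Z$ of the empty graph is $1$. *)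

theory Defs
  imports Complex_Main "Graph_Theory.Pair_Digraph"
    "HOL-Computational_Algebra.Polynomial_FPS"
begin

text \<open>
  Finite simple graphs are values of type \<open>'a pair_pre_digraph\<close> satisfying \<open>pair_graph\<close>
  (finite, loop-free, symmetric): an edge \<open>{u, v}\<close> is represented by the two arcs
  \<open>(u, v)\<close> and \<open>(v, u)\<close>.
\<close>

definition path_graph :: "nat \<Rightarrow> nat pair_pre_digraph" where
  "path_graph m =
     \<lparr> pverts = {..<m},
       parcs = {(i, j). i < m \<and> j < m \<and> (j = Suc i \<or> i = Suc j)} \<rparr>"

text \<open>
  Arcs form a set, so for \<open>n = 2\<close> the two directions around the cycle give the same edge and
  the convention \<open>C\<^sub>2 = P\<^sub>2\<close> holds. The guard \<open>i \<noteq> j\<close> matters only for \<open>n = 1\<close>, where it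
  removes the loop.
\<close>

definition cycle_graph :: "nat \<Rightarrow> nat pair_pre_digraph" where
  "cycle_graph n =
     \<lparr> pverts = {..<n},
       parcs = {(i, j). i < n \<and> j < n \<and> i \<noteq> j \<and>
                  (j = Suc i mod n \<or> i = Suc j mod n)} \<rparr>"

definition graph_prod ::
    "'a pair_pre_digraph \<Rightarrow> 'b pair_pre_digraph \<Rightarrow> ('a \<times> 'b) pair_pre_digraph" where
  "graph_prod G H =
     \<lparr> pverts = pverts G \<times> pverts H,
       parcs = {((u, v), (u', v')).
                  (u = u' \<and> u \<in> pverts G \<and> (v, v') \<in> parcs H) \<or>
                  (v = v' \<and> v \<in> pverts H \<and> (u, u') \<in> parcs G)} \<rparr>"

text \<open>
  An abstract simplicial complex is a down-closed set of finite sets; the empty simplex is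
  included.
\<close>

definition independence_complex :: "'a pair_pre_digraph \<Rightarrow> 'a set set" where
  "independence_complex G =
     {S. S \<subseteq> pverts G \<and> (\<forall>u\<in>S. \<forall>v\<in>S. (u, v) \<notin> parcs G)}"

text \<open>
  The unreduced Euler characteristic: the alternating count of the nonempty simplices, where
  \<open>\<sigma>\<close> has dimension \<open>card \<sigma> - 1\<close>.
\<close>

definition euler_characteristic :: "'a set set \<Rightarrow> int" where
  "euler_characteristic X = (\<Sum>\<sigma>\<in>X - {{}}. (- 1) ^ (card \<sigma> - 1))"

definition Z_complex :: "'a set set \<Rightarrow> int" where
  "Z_complex X = 1 - euler_characteristic X"

definition Z_graph :: "'a pair_pre_digraph \<Rightarrow> int" where
  "Z_graph G = Z_complex (independence_complex G)"

lemma pair_graph_path_graph: "pair_graph (path_graph m)"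
proof
  show "finite (parcs (path_graph m))"
    by (rule finite_subset[of _ "{..<m} \<times> {..<m}"]) (auto simp: path_graph_def)
qed (auto simp: path_graph_def arc_to_ends_def symmetric_def sym_def)

lemma pair_graph_cycle_graph: "pair_graph (cycle_graph n)"
proof
  show "finite (parcs (cycle_graph n))"
    by (rule finite_subset[of _ "{..<n} \<times> {..<n}"]) (auto simp: cycle_graph_def)
qed (auto simp: cycle_graph_def arc_to_ends_def symmetric_def sym_def)

lemma pair_graph_graph_prod:
  assumes "pair_graph G" and "pair_graph H"
  shows "pair_graph (graph_prod G H)"
proof -
  interpret G: pair_graph G by fact
  interpret H: pair_graph H by fact
  have symG: "(u, v) \<in> parcs G \<Longrightarrow> (v, u) \<in> parcs G" for u v
    using G.sym_arcs by (auto simp: symmetric_def sym_def)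
  have symH: "(u, v) \<in> parcs H \<Longrightarrow> (v, u) \<in> parcs H" for u v
    using H.sym_arcs by (auto simp: symmetric_def sym_def)
  have arcsG: "(u, v) \<in> parcs G \<Longrightarrow> u \<in> pverts G \<and> v \<in> pverts G \<and> u \<noteq> v" for u v
    using G.in_arcsD1 G.in_arcsD2 G.no_loops by fastforce
  have arcsH: "(u, v) \<in> parcs H \<Longrightarrow> u \<in> pverts H \<and> v \<in> pverts H \<and> u \<noteq> v" for u v
    using H.in_arcsD1 H.in_arcsD2 H.no_loops by fastforce
  let ?V = "pverts G \<times> pverts H"
  show ?thesis
  proof
    show "finite (parcs (graph_prod G H))"
      by (rule finite_subset[of _ "?V \<times> ?V"])
        (auto simp: graph_prod_def dest: arcsG arcsH)
  qed (auto simp: graph_prod_def symmetric_def intro!: symI dest: arcsG arcsH symG symH)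
qed

lemma path_graph_0: "path_graph 0 = \<lparr> pverts = {}, parcs = {} \<rparr>"
  by (simp add: path_graph_def)

lemma cycle_graph_2: "cycle_graph 2 = path_graph 2"
  by (auto simp: cycle_graph_def path_graph_def less_2_cases_iff)

lemma finite_independence_complex:
  "finite (pverts G) \<Longrightarrow> finite (independence_complex G)"
  by (rule finite_subset[of _ "Pow (pverts G)"]) (auto simp: independence_complex_def)

lemma independence_complex_down_closed:
  "S \<in> independence_complex G \<Longrightarrow> T \<subseteq> S \<Longrightarrow> T \<in> independence_complex G"
  by (auto simp: independence_complex_def)

lemma Z_graph_eq_sum:
  assumes "finite (pverts G)"
  shows "Z_graph G = (\<Sum>\<sigma>\<in>independence_complex G. (- 1) ^ card \<sigma>)"
proof -
  let ?X = "independence_complex G"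
  have fin: "finite ?X"
    using assms by (rule finite_independence_complex)
  have card: "card \<sigma> = Suc (card \<sigma> - 1)" if "\<sigma> \<in> ?X - {{}}" for \<sigma>
    using that assms finite_subset[of \<sigma> "pverts G"]
    by (auto simp: independence_complex_def Suc_diff_1 card_gt_0_iff)
  have "{} \<in> ?X"
    by (simp add: independence_complex_def)
  then have "(\<Sum>\<sigma>\<in>?X. (- 1 :: int) ^ card \<sigma>) = 1 + (\<Sum>\<sigma>\<in>?X - {{}}. (- 1) ^ card \<sigma>)"
    using fin by (simp add: sum.remove)
  also have "(\<Sum>\<sigma>\<in>?X - {{}}. (- 1 :: int) ^ card \<sigma>)
      = (\<Sum>\<sigma>\<in>?X - {{}}. - ((- 1) ^ (card \<sigma> - 1)))"
    by (rule sum.cong[OF refl], subst card) auto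
  finally show ?thesis
    by (simp add: Z_graph_def Z_complex_def euler_characteristic_def sum_negf)
qed

end

theory Submission
  imports Defs
begin

text \<open>
  Cut the cylinder along a height function \<open>h\<close> on its columns and let \<open>W h m\<close> be the
  alternating count for the vertices \<open>(i, j)\<close> with \<open>h j \<le> i < m\<close>. Deleting vertices by
  \<open>Z(G) = Z(G - v) - Z(G - N[v])\<close> changes \<open>h\<close>. A local minimum \<open>1 0 1\<close> of \<open>h\<close> becomes
  \<open>2 3 2\<close> at the cost of a sign, and the centre of a flat piece \<open>1 1 1\<close> can be branched on, which
  yields \<open>1 2 1\<close> minus \<open>2 3 2\<close>.

  Consider cyclic words in the letters 0 and 2 in which equal neighbouring letters are separated by
  a single 1, or by 111 if both are 2, and distinct ones by 1 or 11. Processing all minima and all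
  flat pieces 111 of such a word, and lowering everything by one row, gives words of the same kind.
  The boundaries between blocks of zeros and blocks of twos behave like particles moving around the
  cylinder: at a flat piece 111 a left-moving and a right-moving one meet, and the two branches are
  their annihilation (\<open>1 2 1\<close>) and their passing through each other (\<open>2 3 2\<close>). Hence, up to series
  of words with fewer particles, the generating function of a word is \<open>\<plusminus>t\<close> times that of its image
  under a self-map of a finite set, and induction on the number of particles gives denominators that
  are products of factors \<open>1 \<plusminus> t\<^sup>k\<close>. On an even cycle, branching on the even columns of the top
  row expresses the flat cylinder through such words.
\<close>

section \<open>Alternating counts of independent sets\<close>

definition indep_sum :: "('v \<Rightarrow> 'v \<Rightarrow> bool) \<Rightarrow> 'v set \<Rightarrow> int" where
  "indep_sum adj V = (\<Sum>\<sigma> | \<sigma> \<subseteq> V \<and> (\<forall>u\<in>\<sigma>. \<forall>v\<in>\<sigma>. \<not> adj u v). (- 1) ^ card \<sigma>)"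

text \<open>Removing \<open>v\<close> matches the independent sets through \<open>v\<close> with
  those avoiding its closed neighbourhood; one element fewer flips the sign.\<close>

lemma indep_sum_remove:
  assumes "finite V" and "v \<in> V"
    and irrefl: "\<not> adj v v" and sym: "\<And>u. adj u v = adj v u"
  shows "indep_sum adj V = indep_sum adj (V - {v}) - indep_sum adj (V - {v} - {u. adj v u})"
proof -
  let ?I = "\<lambda>V. {\<sigma>. \<sigma> \<subseteq> V \<and> (\<forall>u\<in>\<sigma>. \<forall>w\<in>\<sigma>. \<not> adj u w)}"
  let ?N = "V - {v} - {u. adj v u}"
  have fin: "finite (?I U)" if "finite U" for U
    using that by (auto intro: finite_subset[of _ "Pow U"])
  have eq: "?I V = ?I (V - {v}) \<union> insert v ` ?I ?N" (is "?L = ?R")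
  proof
    show "?L \<subseteq> ?R"
    proof
      fix \<sigma> assume s: "\<sigma> \<in> ?L"
      show "\<sigma> \<in> ?R"
      proof (cases "v \<in> \<sigma>")
        case True
        then have "\<sigma> = insert v (\<sigma> - {v})" "\<sigma> - {v} \<in> ?I ?N"
          using s by auto
        then show ?thesis by blast
      qed (use s in auto)
    qed
    have "adj u v \<Longrightarrow> adj v u" for u
      using sym by simp
    then show "?R \<subseteq> ?L"
      using \<open>v \<in> V\<close> irrefl by blast
  qed
  have inj: "inj_on (insert v) (?I ?N)"
    by (rule inj_onI) (smt (verit) Diff_iff insert_ident mem_Collect_eq singletonI subset_iff)
  have "(\<Sum>\<sigma>\<in>insert v ` ?I ?N. (- 1 :: int) ^ card \<sigma>)
      = (\<Sum>\<sigma>\<in>?I ?N. (- 1) ^ card (insert v \<sigma>))"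
    using inj by (simp add: sum.reindex)
  also have "\<dots> = (\<Sum>\<sigma>\<in>?I ?N. - ((- 1) ^ card \<sigma>))"
  proof (rule sum.cong[OF refl])
    fix \<sigma> assume "\<sigma> \<in> ?I ?N"
    then have "finite \<sigma>" "v \<notin> \<sigma>"
      using \<open>finite V\<close> by (auto intro: finite_subset)
    then show "(- 1 :: int) ^ card (insert v \<sigma>) = - ((- 1) ^ card \<sigma>)"
      by simp
  qed
  finally have "(\<Sum>\<sigma>\<in>insert v ` ?I ?N. (- 1 :: int) ^ card \<sigma>) = - indep_sum adj ?N"
    by (simp add: indep_sum_def sum_negf)
  moreover have "?I (V - {v}) \<inter> insert v ` ?I ?N = {}"
    by auto
  ultimately show ?thesis
    using \<open>finite V\<close> unfolding indep_sum_def[of adj V] eq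
    by (subst sum.union_disjoint) (auto simp: fin indep_sum_def)
qed

lemma indep_sum_isolated:
  assumes "finite V" and "v \<in> V" and "\<not> adj v v" and "\<And>u. adj u v = adj v u"
    and "\<And>u. u \<in> V \<Longrightarrow> \<not> adj v u"
  shows "indep_sum adj V = 0"
proof -
  have "V - {v} - {u. adj v u} = V - {v}"
    using assms(5) by auto
  then show ?thesis
    using indep_sum_remove[where adj = adj, OF assms(1-4)] by simp
qed

lemma indep_sum_image:
  assumes "inj_on f V" and "\<And>u v. u \<in> V \<Longrightarrow> v \<in> V \<Longrightarrow> adj (f u) (f v) = adj u v"
  shows "indep_sum adj (f ` V) = indep_sum adj V"
proof -
  let ?I = "\<lambda>V. {\<sigma>. \<sigma> \<subseteq> V \<and> (\<forall>u\<in>\<sigma>. \<forall>w\<in>\<sigma>. \<not> adj u w)}"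
  have eq: "?I (f ` V) = (`) f ` ?I V"
  proof (intro equalityI subsetI)
    fix \<sigma> assume s: "\<sigma> \<in> ?I (f ` V)"
    then obtain \<tau> where "\<tau> \<subseteq> V" "\<sigma> = f ` \<tau>"
      by (auto simp: subset_image_iff)
    then show "\<sigma> \<in> (`) f ` ?I V"
      using s assms(2) by (auto simp: subset_iff)
  qed (use assms(2) in \<open>auto simp: subset_iff\<close>)
  have "inj_on ((`) f) (?I V)"
    using inj_on_image_Pow[OF assms(1)] by (rule inj_on_subset) auto
  moreover have "card (f ` \<sigma>) = card \<sigma>" if "\<sigma> \<subseteq> V" for \<sigma>
    using assms(1) that by (meson card_image inj_on_subset)
  ultimately show ?thesis
    unfolding indep_sum_def eq by (simp add: sum.reindex)
qed

section \<open>Power series with cyclotomic denominators\<close>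

definition unity_roots_only :: "complex poly \<Rightarrow> bool" where
  "unity_roots_only q \<longleftrightarrow> q \<noteq> 0 \<and> (\<forall>z. poly q z = 0 \<longrightarrow> (\<exists>k::nat. k > 0 \<and> z ^ k = 1))"

text \<open>The product form avoids division of power series and lets denominators simply
  multiply.\<close>

definition cyclotomic_rational :: "complex fps \<Rightarrow> bool" where
  "cyclotomic_rational f \<longleftrightarrow>
     (\<exists>p q. unity_roots_only q \<and> fps_of_poly q * f = fps_of_poly p)"

lemma unity_roots_only_mult:
  "unity_roots_only p \<Longrightarrow> unity_roots_only q \<Longrightarrow> unity_roots_only (p * q)"
  by (auto simp: unity_roots_only_def)

lemma cyclotomic_rational_poly [simp]: "cyclotomic_rational (fps_of_poly p)"
  unfolding cyclotomic_rational_def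
  by (intro exI[of _ p] exI[of _ 1]) (simp add: unity_roots_only_def)

lemma cyclotomic_rational_0 [simp]: "cyclotomic_rational 0"
  using cyclotomic_rational_poly[of 0] by simp

lemma cyclotomic_rational_add:
  assumes "cyclotomic_rational f" and "cyclotomic_rational g"
  shows "cyclotomic_rational (f + g)"
proof -
  obtain p q p' q' where *: "unity_roots_only q" "fps_of_poly q * f = fps_of_poly p"
      "unity_roots_only q'" "fps_of_poly q' * g = fps_of_poly p'"
    using assms by (auto simp: cyclotomic_rational_def)
  have "fps_of_poly (q * q') * (f + g)
      = fps_of_poly q' * (fps_of_poly q * f) + fps_of_poly q * (fps_of_poly q' * g)"
    by (simp add: fps_of_poly_mult algebra_simps)
  also have "\<dots> = fps_of_poly (q' * p + q * p')"
    using * by (simp add: fps_of_poly_mult fps_of_poly_add)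
  finally show ?thesis
    using * unity_roots_only_mult unfolding cyclotomic_rational_def by blast
qed

lemma cyclotomic_rational_mult_poly:
  assumes "cyclotomic_rational f"
  shows "cyclotomic_rational (fps_of_poly r * f)"
proof -
  obtain p q where *: "unity_roots_only q" "fps_of_poly q * f = fps_of_poly p"
    using assms by (auto simp: cyclotomic_rational_def)
  have "fps_of_poly q * (fps_of_poly r * f) = fps_of_poly (r * p)"
    using * by (simp add: fps_of_poly_mult algebra_simps)
  then show ?thesis
    using * unfolding cyclotomic_rational_def by blast
qed

lemma cyclotomic_rational_sum:
  "(\<And>i. i \<in> A \<Longrightarrow> cyclotomic_rational (f i)) \<Longrightarrow> cyclotomic_rational (\<Sum>i\<in>A. f i)"
  by (induction A rule: infinite_finite_induct) (auto intro: cyclotomic_rational_add)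

lemma cyclotomic_rational_cancel:
  assumes "unity_roots_only r" and "cyclotomic_rational (fps_of_poly r * f)"
  shows "cyclotomic_rational f"
proof -
  obtain p q where *: "unity_roots_only q" "fps_of_poly q * (fps_of_poly r * f) = fps_of_poly p"
    using assms by (auto simp: cyclotomic_rational_def)
  then have "fps_of_poly (q * r) * f = fps_of_poly p"
    by (simp add: fps_of_poly_mult algebra_simps)
  then show ?thesis
    using * assms(1) unity_roots_only_mult unfolding cyclotomic_rational_def by blast
qed

text \<open>Absorbs the finitely many initial coefficients to which a recursion over rows does not
  apply.\<close>

lemma cyclotomic_rational_eventually_eq:
  assumes "cyclotomic_rational g" and "\<And>m. m \<ge> k \<Longrightarrow> fps_nth f m = fps_nth g m"
  shows "cyclotomic_rational f"
proof -
  have "f - g = fps_of_poly (\<Sum>i<k. monom (fps_nth (f - g) i) i)"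
    using assms(2) by (intro fps_ext) (auto simp: coeff_sum not_less)
  then have "cyclotomic_rational (f - g + g)"
    using assms(1) cyclotomic_rational_add cyclotomic_rational_poly by metis
  then show ?thesis
    by simp
qed

lemma unity_roots_only_1_minus_monom:
  assumes "c = 1 \<or> c = - 1" and "p > 0"
  shows "unity_roots_only (1 - monom c p)"
proof -
  have "poly (1 - monom c p) 0 = 1"
    using assms(2) by (simp add: poly_monom)
  then have "1 - monom c p \<noteq> 0"
    by force
  \<comment> \<open>The exponent \<open>2 * p\<close> covers both signs of \<open>c\<close>.\<close>
  moreover have "z ^ (2 * p) = 1" if "poly (1 - monom c p) z = 0" for z
  proof -
    have "z ^ p = 1 \<or> z ^ p = - 1"
      using that assms(1) by (auto simp: poly_monom) (metis minus_minus)
    then show ?thesis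
      by (auto simp: mult.commute[of 2] power_mult)
  qed
  ultimately show ?thesis
    unfolding unity_roots_only_def using assms(2) by (metis mult_pos_pos zero_less_numeral)
qed

text \<open>An orbit of \<open>T\<close> ends in a cycle, on which \<open>G g\<close> equals \<open>\<plusminus>X\<^sup>p G g\<close> up to a
  cyclotomic rational series.\<close>

lemma cyclotomic_rational_orbit:
  fixes G :: "'s \<Rightarrow> complex fps"
  assumes "finite S" and T: "\<And>h. h \<in> S \<Longrightarrow> T h \<in> S"
    and G: "\<And>h. h \<in> S \<Longrightarrow> \<exists>c. (c = 1 \<or> c = - 1) \<and>
      cyclotomic_rational (G h - fps_of_poly (monom c 1) * G (T h))"
    and "h \<in> S"
  shows "cyclotomic_rational (G h)"
proof -
  have in_S: "(T ^^ k) g \<in> S" if "g \<in> S" for g k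
    using that T by (induction k) auto
  have iter: "\<exists>c. (c = 1 \<or> c = - 1) \<and>
      cyclotomic_rational (G g - fps_of_poly (monom c k) * G ((T ^^ k) g))" if "g \<in> S" for g k
  proof (induction k)
    case 0
    show ?case
      by (intro exI[of _ 1]) simp
  next
    case (Suc k)
    let ?g = "(T ^^ k) g"
    obtain c where c: "c = 1 \<or> c = - 1"
        "cyclotomic_rational (G g - fps_of_poly (monom c k) * G ?g)"
      using Suc by blast
    obtain d where d: "d = 1 \<or> d = - 1"
        "cyclotomic_rational (G ?g - fps_of_poly (monom d 1) * G (T ?g))"
      using G in_S \<open>g \<in> S\<close> by blast
    have "cyclotomic_rational (G g - fps_of_poly (monom c k) * G ?g
        + fps_of_poly (monom c k) * (G ?g - fps_of_poly (monom d 1) * G (T ?g)))"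
      using c d by (intro cyclotomic_rational_add cyclotomic_rational_mult_poly)
    also have "G g - fps_of_poly (monom c k) * G ?g
        + fps_of_poly (monom c k) * (G ?g - fps_of_poly (monom d 1) * G (T ?g))
        = G g - fps_of_poly (monom c k * monom d 1) * G (T ?g)"
      by (simp only: fps_of_poly_mult algebra_simps)
    also have "\<dots> = G g - fps_of_poly (monom (c * d) (Suc k)) * G ((T ^^ Suc k) g)"
      by (simp add: mult_monom)
    finally show ?case
      using c(1) d(1) by (intro exI[of _ "c * d"]) auto
  qed
  have "\<not> inj (\<lambda>k. (T ^^ k) h)"
    using in_S[OF \<open>h \<in> S\<close>] \<open>finite S\<close>
    by (meson finite_imageD finite_subset image_subsetI infinite_UNIV_nat)
  then obtain a b where ab: "(T ^^ a) h = (T ^^ b) h" "a < b"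
    unfolding inj_def by (metis linorder_neqE_nat)
  define g where "g = (T ^^ a) h"
  have "(T ^^ (b - a)) g = g"
    using ab unfolding g_def by (metis comp_apply funpow_add le_add_diff_inverse2 less_imp_le)
  then obtain c where c: "c = 1 \<or> c = - 1"
      "cyclotomic_rational (G g - fps_of_poly (monom c (b - a)) * G g)"
    using iter[of g "b - a"] in_S[OF \<open>h \<in> S\<close>] by (auto simp: g_def)
  have "G g - fps_of_poly (monom c (b - a)) * G g = fps_of_poly (1 - monom c (b - a)) * G g"
    by (simp add: fps_of_poly_diff algebra_simps)
  then have "cyclotomic_rational (G g)"
    using c ab(2) cyclotomic_rational_cancel unity_roots_only_1_minus_monom
    by (metis zero_less_diff)
  moreover obtain d where "cyclotomic_rational (G h - fps_of_poly (monom d a) * G g)"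
    using iter[OF \<open>h \<in> S\<close>] unfolding g_def by blast
  ultimately show ?thesis
    using cyclotomic_rational_add[OF _ cyclotomic_rational_mult_poly] by (metis diff_add_cancel)
qed

section \<open>Regions below a height function\<close>

text \<open>\<open>nx\<close> and \<open>pv\<close> may coincide, so the cycle with two columns is
  covered.\<close>

locale cyclic_columns =
  fixes J :: "'a set" and nx pv :: "'a \<Rightarrow> 'a"
  assumes finite_J: "finite J"
    and nx_in [simp]: "j \<in> J \<Longrightarrow> nx j \<in> J"
    and pv_in [simp]: "j \<in> J \<Longrightarrow> pv j \<in> J"
    and pv_nx [simp]: "j \<in> J \<Longrightarrow> pv (nx j) = j"
    and nx_pv [simp]: "j \<in> J \<Longrightarrow> nx (pv j) = j"
    and nx_neq [simp]: "j \<in> J \<Longrightarrow> nx j \<noteq> j"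
begin

lemma pv_neq [simp]: "j \<in> J \<Longrightarrow> pv j \<noteq> j"
  by (metis nx_neq nx_pv)

definition adj :: "nat \<times> 'a \<Rightarrow> nat \<times> 'a \<Rightarrow> bool" where
  "adj u v \<longleftrightarrow> snd u \<in> J \<and> snd v \<in> J \<and>
     (fst u = fst v \<and> (snd v = nx (snd u) \<or> snd u = nx (snd v)) \<or>
      snd u = snd v \<and> (fst v = Suc (fst u) \<or> fst u = Suc (fst v)))"

lemma adj_sym: "adj u v = adj v u"
  by (auto simp: adj_def)

lemma adj_irrefl [simp]: "\<not> adj u u"
  by (metis adj_def n_not_Suc_n nx_neq)

definition region :: "('a \<Rightarrow> nat) \<Rightarrow> nat \<Rightarrow> (nat \<times> 'a) set" where
  "region h m = {(i, j). j \<in> J \<and> h j \<le> i \<and> i < m}"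

definition W :: "('a \<Rightarrow> nat) \<Rightarrow> nat \<Rightarrow> int" where
  "W h m = indep_sum adj (region h m)"

text \<open>If \<open>h = l\<close> on \<open>E \<union> Y\<close> and \<open>h \<ge> l\<close> next to \<open>E\<close>, then \<open>raise\<close> deletes the vertices
  \<open>(l, j)\<close> for \<open>j \<in> Y\<close> and the closed neighbourhoods of the vertices \<open>(l, j)\<close> for \<open>j \<in> E\<close>. At a
  local minimum \<open>j\<close> of height \<open>l - 1\<close>, putting \<open>j\<close> into \<open>E\<close> instead treats the vertex below the
  top one.\<close>

definition raise :: "nat \<Rightarrow> 'a set \<Rightarrow> 'a set \<Rightarrow> ('a \<Rightarrow> nat) \<Rightarrow> 'a \<Rightarrow> nat" where
  "raise l E Y h j = max (h j)
     (if j \<in> E then l + 2 else if j \<in> Y \<or> nx j \<in> E \<or> pv j \<in> E then l + 1 else 0)"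

lemma finite_region [simp]: "finite (region h m)"
  by (rule finite_subset[of _ "{..<m} \<times> J"]) (auto simp: region_def finite_J)

lemma W_cong: "(\<And>j. j \<in> J \<Longrightarrow> h j = g j) \<Longrightarrow> W h m = W g m"
  unfolding W_def region_def by (metis (no_types, lifting))

lemma W_Suc: "W (\<lambda>j. Suc (h j)) (Suc m) = W h m"
proof -
  let ?f = "\<lambda>(i, j). (Suc i, j :: 'a)"
  have "region (\<lambda>j. Suc (h j)) (Suc m) = ?f ` region h m"
  proof (intro equalityI subsetI)
    fix x assume "x \<in> region (\<lambda>j. Suc (h j)) (Suc m)"
    then have "x = ?f (fst x - 1, snd x)" "(fst x - 1, snd x) \<in> region h m"
      by (auto simp: region_def)
    then show "x \<in> ?f ` region h m"
      by blast
  qed (auto simp: region_def)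
  moreover have "indep_sum adj (?f ` region h m) = indep_sum adj (region h m)"
    by (rule indep_sum_image) (auto simp: inj_on_def adj_def)
  ultimately show ?thesis
    by (simp add: W_def)
qed

lemma raise_raise: "raise l E Y (raise l E' Y' h) = raise l (E \<union> E') (Y \<union> Y') h"
  by (auto simp: raise_def fun_eq_iff max_def)

lemma raise_empty [simp]: "raise l {} {} h = h"
  by (auto simp: raise_def)

lemma adj_iff:
  "c \<in> J \<Longrightarrow> adj (l, c) (i, j) \<longleftrightarrow>
     i = l \<and> (j = nx c \<or> j = pv c) \<or> j = c \<and> (i = Suc l \<or> l = Suc i)"
  unfolding adj_def using nx_in pv_in nx_pv pv_nx by auto

lemma raise_single:
  assumes "c \<in> J" and "j \<in> J"
  shows "raise l {c} Y h j = (if j = c then max (h j) (l + 2)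
     else if j \<in> Y \<or> j = nx c \<or> j = pv c then max (h j) (l + 1) else h j)"
proof -
  have "nx j = c \<longleftrightarrow> j = pv c" "pv j = c \<longleftrightarrow> j = nx c"
    using assms by auto
  then show ?thesis
    by (auto simp: raise_def)
qed

text \<open>Column \<open>c\<close> loses rows \<open>l\<close> and \<open>l + 1\<close>; a
  neighbouring column loses row \<open>l\<close> only if it starts there, so the rest is again a
  region.\<close>

lemma region_raise_single:
  assumes c: "c \<in> J" and "h c = l" and "h (nx c) \<ge> l" and "h (pv c) \<ge> l"
  shows "region (raise l {c} {} h) m = region h m - {(l, c)} - {u. adj (l, c) u}"
proof (intro set_eqI)
  fix x :: "nat \<times> 'a"
  obtain i j where x: "x = (i, j)"
    by fastforce
  show "x \<in> region (raise l {c} {} h) m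
      \<longleftrightarrow> x \<in> region h m - {(l, c)} - {u. adj (l, c) u}"
  proof (cases "j \<in> J")
    case True
    consider "j = c" | "j \<noteq> c" "j = nx c \<or> j = pv c" | "j \<noteq> c" "j \<noteq> nx c" "j \<noteq> pv c"
      by blast
    then show ?thesis
      using assms(2-4) True c unfolding x
      by cases (auto simp: region_def raise_single adj_iff)
  qed (simp add: x region_def)
qed

lemma W_split:
  assumes "c \<in> J" and "h c = l" and "h (nx c) \<ge> l" and "h (pv c) \<ge> l" and "l < m"
  shows "W h m = W (raise l {} {c} h) m - W (raise l {c} {} h) m"
proof -
  have "region (raise l {} {c} h) m = region h m - {(l, c)}"
    using assms by (auto simp: region_def raise_def)
  moreover have "(l, c) \<in> region h m"
    using assms by (simp add: region_def)
  ultimately show ?thesis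
    unfolding W_def region_raise_single[OF assms(1-4)]
    by (metis indep_sum_remove[OF finite_region] adj_sym adj_irrefl)
qed

text \<open>The top vertex of the column \<open>z\<close> has the single neighbour \<open>(1, z)\<close>; deleting that
  neighbour isolates it, so only the independent sets through \<open>(1, z)\<close> contribute.\<close>

lemma W_peak:
  assumes z: "z \<in> J" "h z = 0" and "h (nx z) \<ge> 1" and "h (pv z) \<ge> 1" and "1 < m"
  shows "W h m = - W (raise 1 {z} {} h) m"
proof -
  let ?V = "region h m"
  have isolated: "indep_sum adj (?V - {(1, z)}) = 0"
  proof (rule indep_sum_isolated[of _ "(0, z)"])
    show "\<not> adj (0, z) u" if "u \<in> ?V - {(1, z)}" for u
      using that assms by (cases u) (auto simp: region_def adj_iff)
  qed (use assms in \<open>auto simp: adj_sym region_def intro: finite_subset[OF _ finite_region]\<close>)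
  have "region (raise 1 {z} {} h) m = ?V - {(1, z)} - {u. adj (1, z) u}"
  proof (intro set_eqI)
    fix x :: "nat \<times> 'a"
    obtain i j where x: "x = (i, j)"
      by fastforce
    show "x \<in> region (raise 1 {z} {} h) m \<longleftrightarrow> x \<in> ?V - {(1, z)} - {u. adj (1, z) u}"
    proof (cases "j \<in> J")
      case True
      consider "j = z" | "j \<noteq> z" "j = nx z \<or> j = pv z" | "j \<noteq> z" "j \<noteq> nx z" "j \<noteq> pv z"
        by blast
      then show ?thesis
        using assms True unfolding x
        by cases (auto simp: region_def raise_single adj_iff)
    qed (simp add: x region_def)
  qed
  moreover have "(1, z) \<in> ?V"
    using assms by (simp add: region_def)
  ultimately show ?thesis
    unfolding W_def using isolated
    by (metis indep_sum_remove[OF finite_region] adj_sym adj_irrefl diff_0)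
qed

lemma W_peaks:
  assumes "Z \<subseteq> J" and "\<And>z. z \<in> Z \<Longrightarrow> h z = 0 \<and> h (nx z) \<ge> 1 \<and> h (pv z) \<ge> 1" and "1 < m"
  shows "W h m = (- 1) ^ card Z * W (raise 1 Z {} h) m"
proof -
  have "finite Z"
    using assms(1) finite_J finite_subset by blast
  then show ?thesis
    using assms(1,2)
  proof (induction Z)
    case (insert z Z)
    let ?g = "raise 1 Z {} h"
    have z: "z \<in> J" "h z = 0" "h (nx z) \<ge> 1" "h (pv z) \<ge> 1"
      using insert.prems by auto
    \<comment> \<open>Columns of height 0 are never adjacent, so the raises at \<open>Z\<close>
      leave \<open>z\<close> at height 0.\<close>
    have "nx z \<notin> Z" "pv z \<notin> Z"
      using insert.prems z by (metis insertI2 not_one_le_zero)+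
    then have "W ?g m = - W (raise 1 {z} {} ?g) m"
      using z insert.hyps assms(3) by (intro W_peak) (auto simp: raise_def)
    then show ?case
      using insert by (simp add: raise_raise)
  qed simp
qed

text \<open>\<open>Y\<close> collects the columns whose vertex in row \<open>l\<close> is deleted;
  at the others its closed neighbourhood goes. No two columns of \<open>C\<close> are adjacent, so
  the branchings do not interfere.\<close>

lemma W_splits:
  assumes "C \<subseteq> J"
    and "\<And>c. c \<in> C \<Longrightarrow> h c = l \<and> nx c \<notin> C \<and> h (nx c) \<ge> l \<and> h (pv c) \<ge> l" and "l < m"
  shows "W h m = (\<Sum>Y\<in>Pow C. (- 1) ^ card (C - Y) * W (raise l (C - Y) Y h) m)"
proof -
  have "finite C"
    using assms(1) finite_J finite_subset by blast
  then show ?thesis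
    using assms(1,2)
  proof (induction C)
    case (insert c C)
    let ?t = "\<lambda>C Y. (- 1) ^ card (C - Y) * W (raise l (C - Y) Y h) m"
    have c: "c \<in> J" "h c = l" "h (nx c) \<ge> l" "h (pv c) \<ge> l" "nx c \<notin> C" "pv c \<notin> C"
      using insert.prems nx_pv by (auto, metis)
    have "?t C Y = ?t (insert c C) (insert c Y) + ?t (insert c C) Y" if "Y \<in> Pow C" for Y
    proof -
      let ?g = "raise l (C - Y) Y h"
      have Y: "c \<notin> Y" "insert c C - insert c Y = C - Y" "insert c C - Y = insert c (C - Y)"
        using that insert.hyps by auto
      have "W ?g m = W (raise l {} {c} ?g) m - W (raise l {c} {} ?g) m"
        using c that insert.hyps assms(3) by (intro W_split) (auto simp: raise_def)
      moreover have "card (insert c (C - Y)) = Suc (card (C - Y))"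
        using insert.hyps by simp
      ultimately show ?thesis
        by (simp only: Y raise_raise) (simp add: algebra_simps)
    qed
    moreover have "W h m = (\<Sum>Y\<in>Pow C. ?t C Y)"
      using insert.prems by (intro insert.IH) auto
    ultimately have "W h m
        = (\<Sum>Y\<in>Pow C. ?t (insert c C) (insert c Y)) + (\<Sum>Y\<in>Pow C. ?t (insert c C) Y)"
      by (simp add: sum.distrib)
    also have "(\<Sum>Y\<in>Pow C. ?t (insert c C) (insert c Y))
        = (\<Sum>Y\<in>insert c ` Pow C. ?t (insert c C) Y)"
      using insert.hyps by (subst sum.reindex) (auto simp: inj_on_def)
    also have "(\<Sum>Y\<in>insert c ` Pow C. ?t (insert c C) Y) + (\<Sum>Y\<in>Pow C. ?t (insert c C) Y)
        = (\<Sum>Y\<in>Pow (insert c C). ?t (insert c C) Y)"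
      using insert.hyps by (subst sum.union_disjoint[symmetric]) (auto simp: Pow_insert Un_commute)
    finally show ?case .
  qed simp
qed

section \<open>Tame height functions\<close>

text \<open>A local form of the words described above: the condition on pairs 11 forces 111 to lie
  between twos and excludes 1111. Vanishing outside \<open>J\<close> keeps the set of tame functions
  finite.\<close>

definition tame :: "('a \<Rightarrow> nat) \<Rightarrow> bool" where
  "tame h \<longleftrightarrow> (\<forall>j. j \<notin> J \<longrightarrow> h j = 0) \<and>
     (\<forall>j\<in>J. h j \<le> 2 \<and> (h j = 1 \<or> h (nx j) = 1) \<and>
       (h j = 1 \<and> h (nx j) = 1 \<longrightarrow>
          h (pv j) \<noteq> h (nx (nx j)) \<and> (h (pv j) = 2 \<or> h (nx (nx j)) = 2)))"

definition centers :: "('a \<Rightarrow> nat) \<Rightarrow> 'a set" where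
  "centers h = {j\<in>J. h (pv j) = 1 \<and> h j = 1 \<and> h (nx j) = 1}"

text \<open>Below, \<open>Y\<close> consists of the centres at which the particles annihilate, and \<open>deg\<close> is half
  the number of particles: it counts the blocks of twos, two blocks being separated also by 111.\<close>

definition lifted :: "'a set \<Rightarrow> ('a \<Rightarrow> nat) \<Rightarrow> 'a set" where
  "lifted Y h = {j\<in>J. h j = 0} \<union> (centers h - Y)"

definition step :: "'a set \<Rightarrow> ('a \<Rightarrow> nat) \<Rightarrow> 'a \<Rightarrow> nat" where
  "step Y h j = (if j \<in> J then raise 1 (lifted Y h) Y h j - 1 else 0)"

definition deg :: "('a \<Rightarrow> nat) \<Rightarrow> nat" where
  "deg h = card {j\<in>J. h j = 2 \<and> h (nx (nx j)) \<noteq> 2}"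

lemma tameD:
  assumes "tame h" and "j \<in> J"
  shows "h j = 0 \<or> h j = 1 \<or> h j = 2"
    and "h j = 1 \<or> h (nx j) = 1"
    and "h j = 1 \<or> h (pv j) = 1"
    and "h j = 1 \<Longrightarrow> h (nx j) = 1 \<Longrightarrow>
      h (pv j) \<noteq> h (nx (nx j)) \<and> (h (pv j) = 2 \<or> h (nx (nx j)) = 2)"
proof -
  have "h j \<le> 2"
    using assms unfolding tame_def by blast
  then show "h j = 0 \<or> h j = 1 \<or> h j = 2"
    by linarith
  have "h (pv j) = 1 \<or> h (nx (pv j)) = 1"
    using assms pv_in unfolding tame_def by blast
  then show "h j = 1 \<or> h (pv j) = 1"
    using assms(2) by auto
  show "h j = 1 \<or> h (nx j) = 1"
    using assms unfolding tame_def by blast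
  assume "h j = 1" "h (nx j) = 1"
  then show "h (pv j) \<noteq> h (nx (nx j)) \<and> (h (pv j) = 2 \<or> h (nx (nx j)) = 2)"
    using assms unfolding tame_def by blast
qed

lemma lifted_iff:
  "j \<in> J \<Longrightarrow> j \<in> lifted Y h \<longleftrightarrow>
     h j = 0 \<or> h (pv j) = 1 \<and> h j = 1 \<and> h (nx j) = 1 \<and> j \<notin> Y"
  by (auto simp: lifted_def centers_def)

text \<open>Raising to 3 and dropping a row makes the lifted columns the new twos; an old two
  becomes 1.\<close>

lemma step_eq:
  assumes "tame h" and "Y \<subseteq> centers h" and "j \<in> J"
  shows "step Y h j = (if j \<in> lifted Y h then 2
     else if h j = 2 \<or> j \<in> Y \<or> nx j \<in> lifted Y h \<or> pv j \<in> lifted Y h then 1 else 0)"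
proof -
  have "h j = 0 \<Longrightarrow> j \<in> lifted Y h" and "j \<in> Y \<Longrightarrow> h j = 1"
    using assms by (auto simp: lifted_def centers_def)
  then show ?thesis
    using tameD(1)[OF assms(1,3)] assms(3) by (auto simp: step_def raise_def)
qed

lemma step_eq_2_iff:
  assumes "tame h" and "Y \<subseteq> centers h" and "j \<in> J"
  shows "step Y h j = 2 \<longleftrightarrow> j \<in> lifted Y h"
  using step_eq[OF assms] by auto

lemma step_eq_1_iff:
  assumes "tame h" and "Y \<subseteq> centers h" and "j \<in> J"
  shows "step Y h j = 1 \<longleftrightarrow> j \<notin> lifted Y h \<and>
    (h j = 2 \<or> j \<in> Y \<or> nx j \<in> lifted Y h \<or> pv j \<in> lifted Y h)"
  using step_eq[OF assms] by auto

lemma tame_step: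
  assumes h: "tame h" and Y: "Y \<subseteq> centers h"
  shows "tame (step Y h)"
  unfolding tame_def
proof (rule conjI; intro allI ballI impI)
  fix j assume j: "j \<in> J"
  let ?n = "step Y h"
  let ?k = "nx j"
  have k: "?k \<in> J" "pv j \<in> J" "nx ?k \<in> J" "pv ?k = j"
    using j by auto
  note one = step_eq_1_iff[OF h Y]
  have center: "i \<in> Y \<Longrightarrow> h (pv i) = 1 \<and> h i = 1 \<and> h (nx i) = 1" for i
    using Y by (auto simp: centers_def)
  have not_lifted: "i \<in> J \<Longrightarrow> h i = 2 \<Longrightarrow> i \<notin> lifted Y h" for i
    by (simp add: lifted_iff)
  have "?n j \<le> 2"
    using step_eq[OF h Y j] by simp
  moreover have "?n j = 1 \<or> ?n ?k = 1"
  proof (cases "h j = 2 \<or> h ?k = 2")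
    case True
    then show ?thesis
      using not_lifted one j k by blast
  next
    case False
    then have vals: "h j = 0 \<or> h j = 1" "h ?k = 0 \<or> h ?k = 1" "h j = 1 \<or> h ?k = 1"
      using tameD(1)[OF h j] tameD(1)[OF h k(1)] tameD(2)[OF h j] by auto
    consider "h j = 0" "h ?k = 1" | "h j = 1" "h ?k = 0" | "h j = 1" "h ?k = 1"
      using vals by auto
    then show ?thesis
    proof cases
      case 1
      then have "j \<in> lifted Y h" "?k \<notin> lifted Y h"
        using j k by (simp_all add: lifted_iff)
      then show ?thesis
        using one[OF k(1)] k by simp
    next
      case 2
      then have "?k \<in> lifted Y h" "j \<notin> lifted Y h"
        using j k by (simp_all add: lifted_iff)
      then show ?thesis
        using one[OF j] by simp
    next
      case 3
      \<comment> \<open>A pair 11 has a two on one side; on the other stands a 0, which is lifted,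
        or a 1, which makes the middle of the resulting 111 a centre.\<close>
      then have ne: "h (pv j) \<noteq> h (nx ?k)" and "h (pv j) = 2 \<or> h (nx ?k) = 2"
        using tameD(4)[OF h j] by auto
      then consider "h (pv j) = 2" "h (nx ?k) = 0" | "h (pv j) = 2" "h (nx ?k) = 1"
        | "h (nx ?k) = 2" "h (pv j) = 0" | "h (nx ?k) = 2" "h (pv j) = 1"
        using tameD(1)[OF h k(2)] tameD(1)[OF h k(3)] by metis
      then show ?thesis
      proof cases
        case 1
        then have "nx ?k \<in> lifted Y h" "?k \<notin> lifted Y h"
          using 3 j k by (simp_all add: lifted_iff)
        then show ?thesis
          using one[OF k(1)] by simp
      next
        case 2
        then have "j \<notin> lifted Y h" "?k \<in> lifted Y h \<longleftrightarrow> ?k \<notin> Y"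
          using 3 j k by (simp_all add: lifted_iff)
        then show ?thesis
          using one[OF k(1)] one[OF j] by auto
      next
        case 3
        then have "pv j \<in> lifted Y h" "j \<notin> lifted Y h"
          using \<open>h j = 1\<close> j k by (simp_all add: lifted_iff)
        then show ?thesis
          using one[OF j] by simp
      next
        case 4
        then have "?k \<notin> lifted Y h" "j \<in> lifted Y h \<longleftrightarrow> j \<notin> Y"
          using 3 j k by (simp_all add: lifted_iff)
        then show ?thesis
          using one[OF k(1)] one[OF j] k by auto
      qed
    qed
  qed
  moreover have "?n (pv j) \<noteq> ?n (nx ?k) \<and> (?n (pv j) = 2 \<or> ?n (nx ?k) = 2)"
    if "?n j = 1 \<and> ?n ?k = 1"
  proof -
    have nl: "j \<notin> lifted Y h" "?k \<notin> lifted Y h"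
      and jc: "h j = 2 \<or> j \<in> Y \<or> pv j \<in> lifted Y h"
      and kc: "h ?k = 2 \<or> ?k \<in> Y \<or> nx ?k \<in> lifted Y h"
      using that one j k by auto
    have "h j \<noteq> 0" "h ?k \<noteq> 0"
      using nl j k by (simp_all add: lifted_iff)
    \<comment> \<open>Adjacent new ones arise only from 12 or 21, where the 1 sits next to a lifted
      column: that side becomes 2, while the column beyond the old two is not lifted.\<close>
    then consider "h j = 1" "h ?k = 1" | "h j = 1" "h ?k = 2" | "h j = 2" "h ?k = 1"
      using tameD(1)[OF h j] tameD(1)[OF h k(1)] tameD(2)[OF h j] by auto
    then show ?thesis
    proof cases
      case 1
      then have "h (pv j) = 2 \<or> h (nx ?k) = 2"
        using tameD(4)[OF h j] by auto
      then have False
        using jc kc 1 not_lifted[OF k(2)] not_lifted[OF k(3)] center[of j] center[of ?k] by auto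
      then show ?thesis ..
    next
      case 2
      then have "pv j \<in> lifted Y h"
        using jc center[of j] by auto
      moreover have "nx ?k \<notin> lifted Y h"
        using 2 tameD(2)[OF h k(1)] k by (auto simp: lifted_iff)
      ultimately show ?thesis
        using step_eq_2_iff[OF h Y] k by metis
    next
      case 3
      then have "nx ?k \<in> lifted Y h"
        using kc center[of ?k] k by auto
      moreover have "pv j \<notin> lifted Y h"
        using 3 tameD(3)[OF h j] j k by (auto simp: lifted_iff)
      ultimately show ?thesis
        using step_eq_2_iff[OF h Y] k by metis
    qed
  qed
  ultimately show "?n j \<le> 2 \<and> (?n j = 1 \<or> ?n ?k = 1) \<and>
      (?n j = 1 \<and> ?n ?k = 1 \<longrightarrow>
        ?n (pv j) \<noteq> ?n (nx ?k) \<and> (?n (pv j) = 2 \<or> ?n (nx ?k) = 2))"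
    by blast
qed (simp add: step_def)

text \<open>A shift by two columns matches the twos that do not end a block with those that do not
  start one; the complements among all twos have equal size.\<close>

lemma deg_eq_card_starts: "deg h = card {j\<in>J. h j = 2 \<and> h (pv (pv j)) \<noteq> 2}"
proof -
  let ?A = "{j\<in>J. h j = 2}"
  have fin: "finite ?A"
    using finite_J by simp
  have "card {j\<in>J. h j = 2 \<and> h (nx (nx j)) = 2} = card {j\<in>J. h j = 2 \<and> h (pv (pv j)) = 2}"
    by (rule bij_betw_same_card[of "\<lambda>j. nx (nx j)"],
        rule bij_betw_byWitness[where f' = "\<lambda>j. pv (pv j)"]) auto
  moreover have "card (?A - X) = card ?A - card X" if "X \<subseteq> ?A" for X
    using that fin by (meson card_Diff_subset finite_subset)
  moreover have "{j\<in>J. h j = 2 \<and> h (nx (nx j)) \<noteq> 2} = ?A - {j\<in>J. h j = 2 \<and> h (nx (nx j)) = 2}"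
    "{j\<in>J. h j = 2 \<and> h (pv (pv j)) \<noteq> 2} = ?A - {j\<in>J. h j = 2 \<and> h (pv (pv j)) = 2}"
    by auto
  ultimately show ?thesis
    unfolding deg_def by (simp add: subset_iff)
qed

text \<open>The column \<open>j\<close> ending a block of twos of \<open>step Y h\<close> is sent to the first column
  to the right of \<open>j\<close> where \<open>h\<close> is two; it starts a block of twos of \<open>h\<close>. The columns
  two steps to the right of \<open>Y\<close> are missed.\<close>

lemma deg_step:
  assumes h: "tame h" and Y: "Y \<subseteq> centers h"
  shows "deg (step Y h) \<le> deg h" and "Y \<noteq> {} \<Longrightarrow> deg (step Y h) < deg h"
proof -
  let ?n = "step Y h"
  let ?A = "{j\<in>J. ?n j = 2 \<and> ?n (nx (nx j)) \<noteq> 2}"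
  let ?B = "{j\<in>J. h j = 2 \<and> h (pv (pv j)) \<noteq> 2}"
  define f where "f j = (if h (nx (nx j)) = 2 then nx (nx j) else nx (nx (nx j)))" for j
  \<comment> \<open>At the end \<open>j\<close> of a new block the old word reads 012 or 0112 from
    \<open>j\<close> on, or 1112 with \<open>j\<close> as the centre; hence the two cases of
    \<open>f\<close>.\<close>
  have A: "(h j = 0 \<or> j \<in> centers h - Y) \<and> h (nx j) = 1 \<and>
      (h (nx (nx j)) = 2 \<or> h j = 0 \<and> h (nx (nx j)) = 1 \<and> h (nx (nx (nx j))) = 2)"
    if "j \<in> ?A" for j
  proof -
    have j: "j \<in> J" "j \<in> lifted Y h" "nx (nx j) \<notin> lifted Y h"
      using that step_eq_2_iff[OF h Y] by auto
    then have "h (nx (nx j)) \<noteq> 0"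
      by (simp add: lifted_iff)
    moreover have "h j = 0 \<or> j \<in> centers h - Y"
      using j by (auto simp: lifted_def)
    ultimately show ?thesis
      using j(1) tameD(2)[OF h j(1)] tameD(1)[OF h, of "nx (nx j)"] tameD(4)[OF h j(1)]
        tameD(4)[OF h, of "nx j"]
      by (auto simp: centers_def)
  qed
  have sub: "f ` ?A \<subseteq> ?B"
  proof
    fix k assume "k \<in> f ` ?A"
    then obtain j where "j \<in> ?A" "k = f j"
      by auto
    then show "k \<in> ?B"
      using A[of j] by (auto simp: f_def centers_def)
  qed
  have inj2: "nx (nx i) = nx (nx j) \<Longrightarrow> i = j" if "i \<in> J" "j \<in> J" for i j
    using that by (metis nx_in pv_nx)
  \<comment> \<open>A column \<open>j\<close> other than \<open>k\<close> that reaches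
    \<open>nx (nx k)\<close> must advance three columns, so it is the left neighbour of
    \<open>k\<close>, in the pattern 0112.\<close>
  have neq: "nx j = k \<and> h j = 0"
    if j: "j \<in> ?A" "f j = nx (nx k)" "j \<noteq> k" and k: "k \<in> J" for j k
  proof -
    have "h (nx (nx j)) \<noteq> 2"
      using j k inj2[of j k] by (auto simp: f_def)
    then show ?thesis
      using j k inj2[of "nx j" k] A[OF j(1)] by (auto simp: f_def)
  qed
  have no_clash: False
    if ij: "i \<in> ?A" "j \<in> ?A" "f i = f j" "i \<noteq> j" and 2: "h (nx (nx j)) = 2" for i j
  proof -
    have "nx i = j" "h i = 0"
      using neq[of i j] ij 2 by (auto simp: f_def)
    then show False
      using A[OF ij(1)] A[OF ij(2)] ij(1) by (auto simp: centers_def)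
  qed
  have inj: "inj_on f ?A"
  proof (rule inj_onI, rule ccontr)
    fix i j assume ij: "i \<in> ?A" "j \<in> ?A" "f i = f j" "i \<noteq> j"
    then have "h (nx (nx j)) \<noteq> 2" "h (nx (nx i)) \<noteq> 2"
      using no_clash[of i j] no_clash[of j i] by auto
    then have "nx (nx (nx i)) = nx (nx (nx j))"
      using ij(3) by (simp add: f_def)
    then have "nx i = nx j"
      using ij(1,2) inj2[of "nx i" "nx j"] by simp
    then show False
      using ij pv_nx by (metis (no_types, lifting) mem_Collect_eq)
  qed
  have fin: "finite ?B"
    using finite_J by simp
  have degs: "deg ?n = card ?A" "deg h = card ?B"
    by (simp only: deg_def) (rule deg_eq_card_starts)
  show "deg ?n \<le> deg h"
    unfolding degs using inj sub fin by (rule card_inj_on_le)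
  show "deg ?n < deg h" if ne: "Y \<noteq> {}"
  proof -
    obtain y where y: "y \<in> Y"
      using ne by auto
    then have c: "y \<in> J" "h (pv y) = 1" "h y = 1" "h (nx y) = 1"
      using Y by (auto simp: centers_def)
    then have "h (nx (nx y)) = 2"
      using tameD(4)[OF h, of y] by auto
    then have "nx (nx y) \<in> ?B"
      using c by auto
    \<comment> \<open>A preimage would be the left neighbour of \<open>y\<close> with height 0, but
      next to a centre the height is 1.\<close>
    moreover have "nx (nx y) \<notin> f ` ?A"
    proof
      assume "nx (nx y) \<in> f ` ?A"
      then obtain j where j: "j \<in> ?A" "f j = nx (nx y)"
        by auto
      then have "j \<noteq> y"
        using A[of y] y c by auto
      then show False
        using neq[OF j _ c(1)] j(1) c by auto
    qed
    ultimately have "card (f ` ?A) < card ?B"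
      using sub fin by (intro psubset_card_mono) auto
    then show ?thesis
      unfolding degs using inj by (simp add: card_image)
  qed
qed

section \<open>Recursion over rows and the generating series\<close>

text \<open>All minima are treated first, then every centre is branched on, and \<open>W_Suc\<close>
  drops a row. The bound on \<open>m\<close> ensures that row 1, used by both operations,
  exists.\<close>

lemma W_step:
  assumes h: "tame h" and m: "m \<ge> 1"
  shows "W h (Suc m) = (\<Sum>Y\<in>Pow (centers h).
    (- 1) ^ (card {j\<in>J. h j = 0} + card (centers h - Y)) * W (step Y h) m)"
proof -
  let ?Z = "{j\<in>J. h j = 0}" and ?C = "centers h"
  let ?g = "raise 1 ?Z {} h"
  have "h (nx z) \<ge> 1" "h (pv z) \<ge> 1" if "z \<in> ?Z" for z
    using that tameD(2,3)[OF h, of z] by auto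
  then have "W h (Suc m) = (- 1) ^ card ?Z * W ?g (Suc m)"
    using m by (intro W_peaks) auto
  also have "W ?g (Suc m)
      = (\<Sum>Y\<in>Pow ?C. (- 1) ^ card (?C - Y) * W (raise 1 (?C - Y) Y ?g) (Suc m))"
  proof (rule W_splits)
    fix c assume "c \<in> ?C"
    then have c: "c \<in> J" "h (pv c) = 1" "h c = 1" "h (nx c) = 1"
      by (auto simp: centers_def)
    then have "h (nx (nx c)) = 2"
      using tameD(4)[OF h, of c] by auto
    then show "?g c = 1 \<and> nx c \<notin> ?C \<and> ?g (nx c) \<ge> 1 \<and> ?g (pv c) \<ge> 1"
      using c by (auto simp: raise_def centers_def)
  qed (use m in \<open>auto simp: centers_def\<close>)
  also have "\<dots> = (\<Sum>Y\<in>Pow ?C. (- 1) ^ card (?C - Y) * W (step Y h) m)"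
  proof (rule sum.cong[OF refl])
    fix Y
    have "raise 1 (?C - Y) Y ?g = raise 1 (lifted Y h) Y h"
      by (simp add: raise_raise lifted_def Un_commute)
    \<comment> \<open>No column is left at height 0, so the subtraction in \<open>step\<close> is
      exact.\<close>
    moreover have "W (raise 1 (lifted Y h) Y h) (Suc m) = W (\<lambda>j. Suc (step Y h j)) (Suc m)"
    proof (rule W_cong)
      show "raise 1 (lifted Y h) Y h j = Suc (step Y h j)" if "j \<in> J" for j
        using that by (cases "h j = 0") (auto simp: step_def raise_def lifted_def)
    qed
    ultimately have "W (raise 1 (?C - Y) Y ?g) (Suc m) = W (step Y h) m"
      by (simp only: W_Suc)
    then show "(- 1) ^ card (?C - Y) * W (raise 1 (?C - Y) Y ?g) (Suc m)
        = (- 1) ^ card (?C - Y) * W (step Y h) m"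
      by simp
  qed
  finally show ?thesis
    by (simp add: sum_distrib_left power_add mult.assoc)
qed

definition W_series :: "('a \<Rightarrow> nat) \<Rightarrow> complex fps" where
  "W_series h = Abs_fps (\<lambda>m. of_int (W h m))"

text \<open>The branch \<open>Y = {}\<close>, where all particles pass through each other, is the
  main term; the branches with annihilation are left to \<open>lower\<close>.\<close>

lemma W_series_step:
  assumes h: "tame h"
    and lower: "\<And>Y. Y \<subseteq> centers h \<Longrightarrow> Y \<noteq> {} \<Longrightarrow> cyclotomic_rational (W_series (step Y h))"
  shows "\<exists>c. (c = 1 \<or> c = - 1) \<and>
    cyclotomic_rational (W_series h - fps_of_poly (monom c 1) * W_series (step {} h))"
proof -
  define e :: "'a set \<Rightarrow> complex" where
    "e Y = (- 1) ^ (card {j\<in>J. h j = 0} + card (centers h - Y))" for Y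
  let ?t = "\<lambda>Y. fps_of_poly (monom (e Y) 1) * W_series (step Y h)"
  have t: "fps_nth (?t Y) (Suc m) = e Y * of_int (W (step Y h) m)" for Y m
    by (simp add: fps_of_poly_monom W_series_def mult.assoc)
  have fin: "finite (centers h)"
    using finite_J by (simp add: centers_def)
  have "fps_nth (W_series h - ?t {}) m = fps_nth (\<Sum>Y\<in>Pow (centers h) - {{}}. ?t Y) m"
    if "m \<ge> 2" for m
  proof -
    obtain k where k: "m = Suc k" "k \<ge> 1"
      using \<open>m \<ge> 2\<close> by (cases m) auto
    have "fps_nth (W_series h) m = (\<Sum>Y\<in>Pow (centers h). e Y * of_int (W (step Y h) k))"
      by (simp add: W_series_def k(1) W_step[OF h k(2)] e_def)
    also have "\<dots> = e {} * of_int (W (step {} h) k)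
        + (\<Sum>Y\<in>Pow (centers h) - {{}}. e Y * of_int (W (step Y h) k))"
      using fin by (intro sum.remove) auto
    finally show ?thesis
      unfolding k by (simp add: fps_sum_nth t del: One_nat_def)
  qed
  moreover have "cyclotomic_rational (\<Sum>Y\<in>Pow (centers h) - {{}}. ?t Y)"
    using lower by (intro cyclotomic_rational_sum cyclotomic_rational_mult_poly) auto
  ultimately have "cyclotomic_rational (W_series h - ?t {})"
    using cyclotomic_rational_eventually_eq by blast
  moreover have "e {} = 1 \<or> e {} = - 1"
    unfolding e_def by (metis neg_one_even_power neg_one_odd_power)
  ultimately show ?thesis
    by blast
qed

lemma finite_tame: "finite {h. tame h}"
proof (rule finite_subset)
  show "{h. tame h} \<subseteq> {h. \<forall>j. (j \<in> J \<longrightarrow> h j \<in> {..2}) \<and> (j \<notin> J \<longrightarrow> h j = 0)}"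
    by (auto simp: tame_def)
  show "finite {h. \<forall>j. (j \<in> J \<longrightarrow> h j \<in> {..2::nat}) \<and> (j \<notin> J \<longrightarrow> h j = 0)}"
    using finite_J by (intro finite_set_of_finite_funs) auto
qed

lemma cyclotomic_rational_tame:
  assumes "tame h"
  shows "cyclotomic_rational (W_series h)"
  using assms
proof (induction "deg h" arbitrary: h rule: less_induct)
  case less
  \<comment> \<open>\<open>step {}\<close> is only known not to increase \<open>deg\<close>, hence
    an inequality instead of a fixed degree.\<close>
  let ?S = "{g. tame g \<and> deg g \<le> deg h}"
  show ?case
  proof (rule cyclotomic_rational_orbit[where S = ?S and T = "step {}"])
    show "finite ?S"
      using finite_tame by (rule rev_finite_subset) auto
    fix g assume g: "g \<in> ?S"
    then show "step {} g \<in> ?S"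
      using tame_step[of g "{}"] deg_step(1)[of g "{}"] by auto
    show "\<exists>c. (c = 1 \<or> c = - 1) \<and>
        cyclotomic_rational (W_series g - fps_of_poly (monom c 1) * W_series (step {} g))"
    proof (rule W_series_step)
      fix Y assume "Y \<subseteq> centers g" "Y \<noteq> {}"
      then show "cyclotomic_rational (W_series (step Y g))"
        using g tame_step[of g Y] deg_step(2)[of g Y] by (intro less.hyps) auto
    qed (use g in simp)
  qed (use less.prems in simp)
qed

section \<open>From the flat cylinder to tame words\<close>

text \<open>A pair 11 consists of a column of \<open>B - X\<close> and one outside \<open>B\<close>
  whose other neighbour is in \<open>X\<close> and has height 2; the opposite outer column lies
  outside \<open>B\<close>, so its height is at most 1.\<close>

lemma tame_flat:
  assumes B: "\<And>j. j \<in> J \<Longrightarrow> nx j \<in> B \<longleftrightarrow> j \<notin> B" and "B \<subseteq> J" and X: "X \<subseteq> B"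
  shows "tame (\<lambda>j. if j \<in> J then raise 0 X (B - X) (\<lambda>_. 0) j else 0)" (is "tame ?h")
proof -
  have B': "pv j \<in> B \<longleftrightarrow> j \<notin> B" if "j \<in> J" for j
    using B[of "pv j"] that by auto
  have val: "?h j = (if j \<in> X then 2 else if j \<in> B \<or> nx j \<in> X \<or> pv j \<in> X then 1 else 0)"
    if "j \<in> J" for j
    using that X by (auto simp: raise_def)
  show ?thesis
    unfolding tame_def
  proof (rule conjI; intro allI ballI impI)
    fix j assume j: "j \<in> J"
    let ?k = "nx j"
    have k: "?k \<in> J" "pv j \<in> J" "nx ?k \<in> J" "pv ?k = j"
      using j by auto
    have X_B: "i \<in> X \<Longrightarrow> i \<in> B" for i
      using X by blast
    note vals = val[OF j] val[OF k(1)] val[OF k(2)] val[OF k(3)]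
    note parity = B[OF j] B[OF k(1)] B'[OF j]
    have "?h j \<le> 2"
      unfolding vals by simp
    moreover have "?h j = 1 \<or> ?h ?k = 1"
      unfolding vals using parity X_B[of j] X_B[of ?k] k by auto
    moreover have "?h (pv j) \<noteq> ?h (nx ?k) \<and> (?h (pv j) = 2 \<or> ?h (nx ?k) = 2)"
      if "?h j = 1 \<and> ?h ?k = 1"
      using that unfolding vals
      using parity X_B[of j] X_B[of ?k] X_B[of "pv j"] X_B[of "nx ?k"] k j
      by (auto split: if_splits)
    ultimately show "?h j \<le> 2 \<and> (?h j = 1 \<or> ?h ?k = 1) \<and> (?h j = 1 \<and> ?h ?k = 1 \<longrightarrow>
        ?h (pv j) \<noteq> ?h (nx ?k) \<and> (?h (pv j) = 2 \<or> ?h (nx ?k) = 2))"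
      by blast
  qed simp
qed

lemma cyclotomic_rational_flat:
  assumes B: "\<And>j. j \<in> J \<Longrightarrow> nx j \<in> B \<longleftrightarrow> j \<notin> B" and "B \<subseteq> J"
  shows "cyclotomic_rational (W_series (\<lambda>_. 0))"
proof -
  \<comment> \<open>The cut-off outside \<open>J\<close> is what \<open>tame\<close> asks for and
    does not affect \<open>W\<close>.\<close>
  define g where "g Y j = (if j \<in> J then raise 0 (B - Y) Y (\<lambda>_. 0) j else 0)" for Y j
  let ?t = "\<lambda>Y. fps_of_poly [:(- 1) ^ card (B - Y):] * W_series (g Y)"
  have "fps_nth (W_series (\<lambda>_. 0)) m = fps_nth (\<Sum>Y\<in>Pow B. ?t Y) m" if "m \<ge> 1" for m
  proof -
    have "W (\<lambda>_. 0) m = (\<Sum>Y\<in>Pow B. (- 1) ^ card (B - Y) * W (raise 0 (B - Y) Y (\<lambda>_. 0)) m)"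
      using that B \<open>B \<subseteq> J\<close> by (intro W_splits) auto
    also have "\<dots> = (\<Sum>Y\<in>Pow B. (- 1) ^ card (B - Y) * W (g Y) m)"
      by (intro sum.cong refl arg_cong2[where f = times] W_cong) (simp add: g_def)
    finally show ?thesis
      by (simp add: W_series_def fps_sum_nth fps_of_poly_const)
  qed
  moreover have "cyclotomic_rational (\<Sum>Y\<in>Pow B. ?t Y)"
  proof (intro cyclotomic_rational_sum cyclotomic_rational_mult_poly cyclotomic_rational_tame)
    fix Y assume "Y \<in> Pow B"
    then have eq: "B - (B - Y) = Y"
      by auto
    show "tame (g Y)"
      using tame_flat[OF assms Diff_subset[of B Y]] unfolding g_def[abs_def] eq .
  qed
  ultimately show ?thesis
    using cyclotomic_rational_eventually_eq by blast
qed

end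

section \<open>The standard cycle\<close>

lemma cyclic_columns_mod:
  assumes "N \<ge> 2"
  shows "cyclic_columns {..<N} (\<lambda>j. Suc j mod N) (\<lambda>j. (j + (N - 1)) mod N)"
proof
  fix j assume "j \<in> {..<N}"
  then have j: "j < N"
    by simp
  show "Suc j mod N \<in> {..<N}" "(j + (N - 1)) mod N \<in> {..<N}"
    using assms by auto
  have nx: "Suc j mod N = (if Suc j = N then 0 else Suc j)"
    using j by simp
  then show "Suc j mod N \<noteq> j"
    using assms by simp
  show "(Suc j mod N + (N - 1)) mod N = j"
  proof (cases "Suc j = N")
    case False
    have "Suc j + (N - 1) = j + N"
      using j by simp
    then show ?thesis
      using False nx j by simp
  qed auto
  show "Suc ((j + (N - 1)) mod N) mod N = j"
  proof (cases j)
    case (Suc i)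
    then have "j + (N - 1) = i + N"
      using j by simp
    then show ?thesis
      using Suc j by simp
  qed (use assms in simp)
qed simp

theorem theorem1p3:
  fixes n :: nat
  assumes "n \<ge> 1"
  shows "\<exists>p q :: complex poly.
           q \<noteq> 0 \<and>
           Abs_fps (\<lambda>m. of_int (Z_graph (graph_prod (path_graph m) (cycle_graph (2 * n)))))
             = fps_of_poly p / fps_of_poly q \<and>
           (\<forall>z :: complex. poly q z = 0 \<longrightarrow> (\<exists>k::nat. k > 0 \<and> z ^ k = 1))"
proof -
  let ?N = "2 * n"
  let ?G = "\<lambda>m. graph_prod (path_graph m) (cycle_graph ?N)"
  interpret cyclic_columns "{..<?N}" "\<lambda>j. Suc j mod ?N" "\<lambda>j. (j + (?N - 1)) mod ?N"
    using assms by (intro cyclic_columns_mod) simp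
  have ne: "b \<noteq> Suc b mod ?N" if "b < ?N" for b
    using that nx_neq[of b] by (metis lessThan_iff)
  have "Z_graph (?G m) = W (\<lambda>_. 0) m" for m
  proof -
    have V: "pverts (?G m) = region (\<lambda>_. 0) m"
      by (auto simp: graph_prod_def path_graph_def cycle_graph_def region_def)
    have "(u, v) \<in> parcs (?G m) \<longleftrightarrow> adj u v"
      if "u \<in> region (\<lambda>_. 0) m" "v \<in> region (\<lambda>_. 0) m" for u v
      using that
      by (cases u; cases v)
        (auto simp: graph_prod_def path_graph_def cycle_graph_def region_def adj_def ne)
    then have "independence_complex (?G m) =
        {\<sigma>. \<sigma> \<subseteq> region (\<lambda>_. 0) m \<and> (\<forall>u\<in>\<sigma>. \<forall>v\<in>\<sigma>. \<not> adj u v)}"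
      unfolding independence_complex_def V by blast
    moreover have "finite (pverts (?G m))"
      unfolding V by simp
    ultimately show ?thesis
      by (simp add: Z_graph_eq_sum W_def indep_sum_def)
  qed
  moreover have "cyclotomic_rational (W_series (\<lambda>_. 0))"
  proof (rule cyclotomic_rational_flat)
    \<comment> \<open>The even length enters here: reduction modulo \<open>2 * n\<close> preserves
      parity.\<close>
    show "Suc j mod ?N \<in> {j. j < ?N \<and> even j} \<longleftrightarrow> j \<notin> {j. j < ?N \<and> even j}"
      if "j \<in> {..<?N}" for j
      using that assms by (auto simp: dvd_mod_iff)
  qed auto
  ultimately obtain p q where q: "unity_roots_only q"
    "fps_of_poly q * Abs_fps (\<lambda>m. of_int (Z_graph (?G m))) = fps_of_poly p"
    unfolding cyclotomic_rational_def W_series_def by auto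
  then have "q \<noteq> 0"
    by (simp add: unity_roots_only_def)
  then have "Abs_fps (\<lambda>m. of_int (Z_graph (?G m))) = fps_of_poly p / fps_of_poly q"
    unfolding q(2)[symmetric] by simp
  then show ?thesis
    using q(1) unfolding unity_roots_only_def by blast
qed

end
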